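(* Let $m_1,m_2,m_3>0$ and put $$\Sigma=\frac{(m_3 m_2)^{3/2}}{(m_3+m_2)^{1/2}}+\frac{(m_1 m_3)^{3/2}}{(m_1+m_3)^{1/2}}+\frac{(m_2 m_1)^{3/2}}{(m_2+m_1)^{1/2}} .$$ Let $\alpha>0$ and $T_1=\dfrac{\sqrt{2}\,\pi\,\Sigma}{\alpha^{3/2}}$. Let $t\mapsto (z_1(t),z_2(t),z_3(t))\in\mathbb{C}^3$, $t\in[0,T_1]$, be a collision-free solution of the planar Newtonian three-body problem with masses $m_1,m_2,m_3$ and centre of mass at the origin, having zero angular momentum and negative energy $H=-\alpha$. Then there exists $t_0\in[0,T_1]$ such that the three bodies form a syzygy at $t=t_0$, i.e. the points $z_1(t_0),z_2(t_0),z_3(t_0)$ lie on one straight line.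
   Context: The planar Newtonian three-body problem with masses $m_1,m_2,m_3>0$ is the system, for $z_k=x_k+iy_k\in\mathbb{C}$ and $z_{kl}=z_k-z_l$, $$\ddot z_1=m_2\frac{z_{21}}{|z_{21}|^3}-m_3\frac{z_{13}}{|z_{13}|^3},\quad \ddot z_2=m_3\frac{z_{32}}{|z_{32}|^3}-m_1\frac{z_{21}}{|z_{21}|^3},\quad \ddot z_3=m_1\frac{z_{13}}{|z_{13}|^3}-m_2\frac{z_{32}}{|z_{32}|^3}.$$ Standing assumption: $\sum_k m_k z_k=\sum_k m_k\dot z_k=0$ (centre of mass at the origin). Collision-free on an interval means $z_j(t)\ne z_k(t)$ for all $j\neq k$ and all $t$ in that interval. The energy is $$H=K-U,\qquad K=\tfrac12\sum_{k=1}^3 m_k|\dot z_k|^2,\qquad U=\frac{m_3m_2}{|z_{32}|}+\frac{m_1m_3}{|z_{13}|}+\frac{m_2m_1}{|z_{21}|},$$ and the angular momentum is $\sum_{k=1}^3 m_k(x_k\dot y_k-\dot x_k y_k)$. Both are constant along solutions. *)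

theory Defs
  imports "HOL-Analysis.Analysis"
begin

(* A configuration is a vector in complex^3 whose components 1, 2, 3 are the positions of the
   bodies; here z_kl = z $ k - z $ l. *)

definition newton_acceleration :: "real ^ 3 \<Rightarrow> complex ^ 3 \<Rightarrow> complex ^ 3" where
  "newton_acceleration m z =
    (let z21 = z $ 2 - z $ 1; z13 = z $ 1 - z $ 3; z32 = z $ 3 - z $ 2;
         g = (\<lambda>w::complex. w /\<^sub>R cmod w ^ 3)
     in vector
       [m $ 2 *\<^sub>R g z21 - m $ 3 *\<^sub>R g z13,
        m $ 3 *\<^sub>R g z32 - m $ 1 *\<^sub>R g z21,
        m $ 1 *\<^sub>R g z13 - m $ 2 *\<^sub>R g z32])"

(* v is the velocity of z. Derivatives are taken within I, so they are one-sided at the end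
   points of a closed interval. Collisions are not excluded here: see collision_free_on. *)
definition three_body_solution ::
    "real ^ 3 \<Rightarrow> real set \<Rightarrow> (real \<Rightarrow> complex ^ 3) \<Rightarrow> (real \<Rightarrow> complex ^ 3) \<Rightarrow> bool" where
  "three_body_solution m I z v \<longleftrightarrow>
    (\<forall>t\<in>I. (z has_vector_derivative v t) (at t within I) \<and>
           (v has_vector_derivative newton_acceleration m (z t)) (at t within I))"

definition collision_free_on :: "real set \<Rightarrow> (real \<Rightarrow> complex ^ 3) \<Rightarrow> bool" where
  "collision_free_on I z \<longleftrightarrow> (\<forall>t\<in>I. \<forall>j k. j \<noteq> k \<longrightarrow> z t $ j \<noteq> z t $ k)"

definition kinetic_energy :: "real ^ 3 \<Rightarrow> complex ^ 3 \<Rightarrow> real" where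
  "kinetic_energy m v = 1/2 * (\<Sum>k\<in>UNIV. m $ k * (cmod (v $ k))\<^sup>2)"

definition force_function :: "real ^ 3 \<Rightarrow> complex ^ 3 \<Rightarrow> real" where
  "force_function m z =
     m $ 3 * m $ 2 / cmod (z $ 3 - z $ 2) +
     m $ 1 * m $ 3 / cmod (z $ 1 - z $ 3) +
     m $ 2 * m $ 1 / cmod (z $ 2 - z $ 1)"

definition energy :: "real ^ 3 \<Rightarrow> complex ^ 3 \<Rightarrow> complex ^ 3 \<Rightarrow> real" where
  "energy m z v = kinetic_energy m v - force_function m z"

definition angular_momentum :: "real ^ 3 \<Rightarrow> complex ^ 3 \<Rightarrow> complex ^ 3 \<Rightarrow> real" where
  "angular_momentum m z v =
     (\<Sum>k\<in>UNIV. m $ k * (Re (z $ k) * Im (v $ k) - Re (v $ k) * Im (z $ k)))"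

definition mass_constant :: "real ^ 3 \<Rightarrow> real" where
  "mass_constant m =
     (m $ 3 * m $ 2) powr (3/2) / (m $ 3 + m $ 2) powr (1/2) +
     (m $ 1 * m $ 3) powr (3/2) / (m $ 1 + m $ 3) powr (1/2) +
     (m $ 2 * m $ 1) powr (3/2) / (m $ 2 + m $ 1) powr (1/2)"

definition syzygy :: "complex ^ 3 \<Rightarrow> bool" where
  "syzygy z \<longleftrightarrow> collinear {z $ 1, z $ 2, z $ 3}"

end

theory Submission
  imports Defs
begin

text \<open>
  Let \<open>D\<close> be twice the signed area of the triangle formed by the bodies; a syzygy is a zero of
  \<open>D\<close>. The real parts and the imaginary parts of the positions relative to the centre of mass both
  solve one linear second order system \<open>x'' = - A(t) x\<close>, where the coefficient \<open>A(t)\<close> depends on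
  the mutual distances only. Together they form a fundamental matrix \<open>X\<close> of size two with
  determinant proportional to \<open>D\<close>, and zero angular momentum says that the logarithmic derivative
  \<open>S = X' X\<^sup>-\<^sup>1\<close> is symmetric for the mass scalar product. The zeros of \<open>D\<close> are the focal points
  of this system, so Sturm theory applies: from \<open>S' = - A - S\<^sup>2\<close> and \<open>(tr S)\<^sup>2 \<le> 2 tr S\<^sup>2\<close>, the
  function \<open>u = tr S / 2 = D' / (2 D)\<close> obeys \<open>u' \<le> - u\<^sup>2 - tr A / 2\<close>. A lower bound \<open>2 w\<^sup>2\<close> for
  \<open>tr A\<close> makes \<open>arctan (u / w)\<close> decrease at rate at least \<open>w\<close>, which is impossible for a time
  \<open>pi / w\<close>. Hence \<open>D\<close> vanishes somewhere in every closed interval of that length.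

  The trace of \<open>A\<close> is the sum of \<open>(m\<^sub>j + m\<^sub>k) / r\<^sub>j\<^sub>k\<^sup>3\<close> over the three pairs. Negative energy gives
  \<open>U \<ge> \<alpha>\<close> since the kinetic energy is nonnegative, and the minimum of this sum over
  all positive numbers \<open>r\<^sub>j\<^sub>k\<close> with \<open>U \<ge> \<alpha>\<close> is \<open>\<alpha>\<^sup>3 / \<Sigma>\<^sup>2\<close>. With \<open>2 w\<^sup>2\<close> equal to this minimum, \<open>pi / w\<close> is the time in
  the theorem.

  The matrices do not appear below: the computation is done with the sides of the triangle
  and the wedge product on the plane. The symmetry of \<open>S\<close> enters through
  \<open>wedge_discriminant\<close>, the comparison argument is \<open>zero_in_half_period\<close>, and the minimisation
  is \<open>trace_lower_bound\<close>.
\<close>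

section \<open>A Sturm comparison principle\<close>

text \<open>The Riccati inequality says that \<open>arctan (u / w)\<close> decreases at least at rate \<open>w\<close>, so over a
  time \<open>pi / w\<close> it would have to lose \<open>pi\<close>, the full length of the open range of the arctangent.\<close>

lemma riccati_blow_up:
  fixes u u' :: "real \<Rightarrow> real"
  assumes w: "w > 0"
    and der: "\<And>t. t \<in> {0..pi/w} \<Longrightarrow> (u has_real_derivative u' t) (at t within {0..pi/w})"
    and riccati: "\<And>t. t \<in> {0..pi/w} \<Longrightarrow> u' t \<le> - ((u t)\<^sup>2 + w\<^sup>2)"
  shows False
proof -
  define \<theta> where "\<theta> = (\<lambda>t. arctan (u t / w))"
  define \<theta>' where "\<theta>' = (\<lambda>t. w * u' t / ((u t)\<^sup>2 + w\<^sup>2))"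
  have d: "(\<theta> has_real_derivative \<theta>' t) (at t within {0..pi/w})" if "t \<in> {0..pi/w}" for t
    unfolding \<theta>_def \<theta>'_def using w
    by (auto intro!: derivative_eq_intros der[OF that]
        simp: field_simps power2_eq_square add_nonneg_eq_0_iff)
  have pos: "0 < pi / w" using w by simp
  obtain x where x: "x \<in> {0<..<pi/w}" "\<theta> (pi/w) - \<theta> 0 = (\<lambda>y. y * \<theta>' x) (pi/w - 0)"
    using mvt_simple[OF pos, of \<theta> "\<lambda>t y. y * \<theta>' t"] d
    by (force simp: has_field_derivative_def mult_commute_abs)
  have "\<theta>' x \<le> - w"
  proof -
    have "0 < (u x)\<^sup>2 + w\<^sup>2" using w by (simp add: add_nonneg_pos)
    moreover have "w * u' x \<le> w * (- ((u x)\<^sup>2 + w\<^sup>2))"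
      using riccati[of x] x w by (intro mult_left_mono) auto
    ultimately show ?thesis unfolding \<theta>'_def by (simp add: field_simps)
  qed
  then have "pi / w * \<theta>' x \<le> pi / w * (- w)"
    using pos by (intro mult_left_mono) auto
  then have "\<theta> (pi/w) - \<theta> 0 \<le> - pi" using x w by simp
  moreover have "\<theta> (pi/w) > - pi/2" "\<theta> 0 < pi/2"
    unfolding \<theta>_def using arctan_lbound arctan_ubound by auto
  ultimately show False by linarith
qed

text \<open>For positive \<open>D\<close> the inequality states that \<open>sqrt D\<close> satisfies \<open>y'' \<le> - w\<^sup>2 y\<close>. Its
  logarithmic derivative \<open>D1 / (2 D)\<close> is defined for either sign of \<open>D\<close>.\<close>

lemma zero_in_half_period:
  fixes D D1 D2 :: "real \<Rightarrow> real"
  assumes w: "w > 0"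
    and D: "\<And>t. t \<in> {0..pi/w} \<Longrightarrow> (D has_real_derivative D1 t) (at t within {0..pi/w})"
    and D1: "\<And>t. t \<in> {0..pi/w} \<Longrightarrow> (D1 has_real_derivative D2 t) (at t within {0..pi/w})"
    and ineq: "\<And>t. t \<in> {0..pi/w} \<Longrightarrow> 2 * D t * D2 t \<le> (D1 t)\<^sup>2 - 4 * w\<^sup>2 * (D t)\<^sup>2"
  shows "\<exists>t\<in>{0..pi/w}. D t = 0"
proof (rule ccontr)
  assume "\<not> ?thesis"
  then have nz: "D t \<noteq> 0" if "t \<in> {0..pi/w}" for t using that by blast
  define u' where "u' = (\<lambda>t. (D2 t * D t - (D1 t)\<^sup>2) / (2 * (D t)\<^sup>2))"
  have der: "((\<lambda>t. D1 t / (2 * D t)) has_real_derivative u' t) (at t within {0..pi/w})"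
    if "t \<in> {0..pi/w}" for t
    unfolding u'_def using nz[OF that]
    by (auto intro!: derivative_eq_intros D[OF that] D1[OF that]
        simp: field_simps power2_eq_square)
  have riccati: "u' t \<le> - ((D1 t / (2 * D t))\<^sup>2 + w\<^sup>2)" if "t \<in> {0..pi/w}" for t
  proof -
    have "u' t + ((D1 t / (2 * D t))\<^sup>2 + w\<^sup>2)
        = (2 * D t * D2 t - ((D1 t)\<^sup>2 - 4 * w\<^sup>2 * (D t)\<^sup>2)) / (4 * (D t)\<^sup>2)"
      unfolding u'_def using nz[OF that] by (simp add: field_simps power2_eq_square)
    also have "\<dots> \<le> 0"
      using ineq[OF that] by (intro divide_nonpos_nonneg) auto
    finally show ?thesis by linarith
  qed
  show False by (rule riccati_blow_up[OF w der riccati])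
qed

section \<open>The wedge product on the plane\<close>

definition wedge :: "complex \<Rightarrow> complex \<Rightarrow> real" where
  "wedge a b = Re a * Im b - Im a * Re b"

lemma bounded_bilinear_wedge: "bounded_bilinear wedge"
proof -
  have "wedge = (\<lambda>a b. inner (\<i> * a) b)"
    by (intro ext) (simp add: wedge_def inner_complex_def)
  then show ?thesis
    using bounded_bilinear.comp1[OF bounded_bilinear_inner
        bounded_linear_mult_right[of "\<i> :: complex"]] by simp
qed

lemma has_real_derivative_wedge:
  assumes "(f has_vector_derivative f') (at t within I)"
    and "(g has_vector_derivative g') (at t within I)"
  shows "((\<lambda>t. wedge (f t) (g t)) has_real_derivative wedge f' (g t) + wedge (f t) g')
    (at t within I)"
  using bounded_bilinear.has_vector_derivative[OF bounded_bilinear_wedge assms]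
  by (simp add: has_real_derivative_iff_has_vector_derivative add.commute)

lemma collinear_if_wedge_eq_0:
  assumes "wedge (b - a) (c - a) = 0"
  shows "collinear {a, b, c}"
proof -
  have "Im ((c - a) / (b - a)) = 0"
    using assms by (simp add: wedge_def Im_divide field_simps)
  then have "collinear {0, b - a, c - a}"
    by (simp add: collinear_iff_Reals complex_is_Real_iff)
  then have "collinear {b, a, c}"
    by (simp add: collinear_3[of b a c])
  then show ?thesis by (simp add: insert_commute)
qed

text \<open>If \<open>a\<close> and \<open>b\<close> are linearly independent, write \<open>a' = s\<^sub>1 a + s\<^sub>2 b\<close> and \<open>b' = s\<^sub>3 a + s\<^sub>4 b\<close>.
  The right side minus the left side of the conclusion is then \<open>(wedge a b)\<^sup>2\<close> times the
  discriminant of the characteristic polynomial of the matrix \<open>((s\<^sub>1, s\<^sub>2), (s\<^sub>3, s\<^sub>4))\<close>. The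
  hypothesis \<open>sym\<close> says that this matrix is symmetric for the positive definite form with matrix
  \<open>((P + R, - R), (- R, Q + R))\<close>, so its eigenvalues are real. The proof avoids the case
  distinction by expressing the difference through the Pluecker relation.\<close>

lemma wedge_discriminant:
  assumes P: "P > 0" and Q: "Q > 0" and R: "R > 0"
    and sym: "P * wedge a a' + Q * wedge b b' + R * wedge (b - a) (b' - a') = 0"
  shows "4 * (wedge a b * wedge a' b') \<le> (wedge a' b + wedge a b')\<^sup>2"
proof -
  define x where "x = wedge a a'"
  define y where "y = wedge b b'"
  define h where "h = wedge a b' - wedge a' b"
  have plucker: "(wedge a' b + wedge a b')\<^sup>2 - 4 * (wedge a b * wedge a' b') = h\<^sup>2 - 4 * (x * y)"
    unfolding x_def y_def h_def wedge_def by (simp add: algebra_simps power2_eq_square)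
  have Rh: "R * h = (P + R) * x + (Q + R) * y"
    using sym unfolding x_def y_def h_def wedge_def by (simp add: algebra_simps)
  have "4 * (x * y) \<le> h\<^sup>2"
  proof (cases "x * y \<le> 0")
    case True
    then show ?thesis using zero_le_power2[of h] by linarith
  next
    case False
    have "R\<^sup>2 * (4 * (x * y)) \<le> ((P + R) * (Q + R)) * (4 * (x * y))"
      using False P Q R by (intro mult_right_mono) (auto simp: algebra_simps power2_eq_square)
    also have "\<dots> \<le> ((P + R) * x + (Q + R) * y)\<^sup>2"
      using zero_le_power2[of "(P + R) * x - (Q + R) * y"]
      by (simp add: algebra_simps power2_eq_square)
    also have "\<dots> = R\<^sup>2 * h\<^sup>2" using Rh by (metis power_mult_distrib)
    finally show ?thesis using R by simp
  qed
  then show ?thesis using plucker by linarith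
qed

section \<open>The area of the triangle of bodies\<close>

lemma mutual_angular_momentum:
  assumes "angular_momentum m z v = 0"
    and "(\<Sum>k\<in>UNIV. m $ k *\<^sub>R z $ k) = 0" "(\<Sum>k\<in>UNIV. m $ k *\<^sub>R v $ k) = 0"
  shows "m $ 1 * m $ 2 * wedge (z $ 2 - z $ 1) (v $ 2 - v $ 1) +
      m $ 1 * m $ 3 * wedge (z $ 3 - z $ 1) (v $ 3 - v $ 1) +
      m $ 2 * m $ 3 * wedge (z $ 3 - z $ 2) (v $ 3 - v $ 2) = 0" (is "?J = 0")
proof -
  \<comment> \<open>Lagrange's identity: the pair sum is the total mass times the angular momentum, minus the
    wedge product of the two mass weighted sums, which both vanish.\<close>
  have "?J = (\<Sum>k\<in>UNIV. m $ k) * angular_momentum m z v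
      - wedge (\<Sum>k\<in>UNIV. m $ k *\<^sub>R z $ k) (\<Sum>k\<in>UNIV. m $ k *\<^sub>R v $ k)"
    by (simp add: wedge_def angular_momentum_def sum_3 algebra_simps)
  then show ?thesis using assms by (simp add: wedge_def)
qed

text \<open>Every linear map \<open>L\<close> of a plane satisfies \<open>L a \<and> b + a \<and> L b = (tr L) (a \<and> b)\<close>. Here \<open>L = - A\<close>,
  with \<open>A\<close> the matrix of the linear system \<open>x'' = - A x\<close> solved by either coordinate of the bodies,
  and the factor in brackets is the trace of \<open>A\<close>.\<close>

lemma wedge_newton_acceleration:
  fixes m :: "real ^ 3" and z :: "complex ^ 3"
  defines "acc \<equiv> newton_acceleration m z"
  shows "wedge (acc $ 2 - acc $ 1) (z $ 3 - z $ 1) + wedge (z $ 2 - z $ 1) (acc $ 3 - acc $ 1)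
    = - ((m $ 3 + m $ 2) / cmod (z $ 3 - z $ 2) ^ 3 + (m $ 1 + m $ 3) / cmod (z $ 1 - z $ 3) ^ 3
      + (m $ 2 + m $ 1) / cmod (z $ 2 - z $ 1) ^ 3) * wedge (z $ 2 - z $ 1) (z $ 3 - z $ 1)"
proof -
  define p q r where "p = inverse (cmod (z $ 3 - z $ 2) ^ 3)"
    and "q = inverse (cmod (z $ 1 - z $ 3) ^ 3)" and "r = inverse (cmod (z $ 2 - z $ 1) ^ 3)"
  show ?thesis
    unfolding acc_def newton_acceleration_def Let_def vector_3 divide_inverse
      p_def[symmetric] q_def[symmetric] r_def[symmetric] wedge_def
    by (simp add: algebra_simps)
qed

text \<open>For each pair of bodies let \<open>P\<close> be the product and \<open>M\<close> the sum of their masses, and \<open>x\<close> the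
  inverse of their distance. For a fixed value of \<open>\<Sum> P x\<close> the sum \<open>\<Sum> M x\<^sup>3\<close> is least where
  all \<open>x = c sqrt (P / M)\<close> with a common \<open>c\<close>. The left side of the inequality is the tangent to the
  convex function on the right at this point; its slope is \<open>P\<close> times a factor common to all pairs, so
  that summation over the pairs involves the \<open>x\<close> only through \<open>\<Sum> P x\<close>.\<close>

lemma cube_tangent:
  fixes P M x c :: real
  assumes P: "P > 0" and M: "M > 0" and x: "x \<ge> 0" and c: "c \<ge> 0"
  shows "3 * c\<^sup>2 * (P * x) - 2 * c ^ 3 * (P powr (3/2) / M powr (1/2)) \<le> M * x ^ 3"
proof -
  define g where "g = sqrt (P / M)"
  have g: "g \<ge> 0" "M * g\<^sup>2 = P" using P M by (simp_all add: g_def)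
  have "P powr (3/2) = P * sqrt P"
    using P powr_add[of P 1 "1/2"] by (simp add: powr_half_sqrt)
  then have S: "P powr (3/2) / M powr (1/2) = M * g ^ 3"
    using P M g by (simp add: g_def real_sqrt_divide powr_half_sqrt power3_eq_cube)
  have "0 \<le> M * ((x - c * g)\<^sup>2 * (x + 2 * (c * g)))"
    using M x c g by simp
  also have "\<dots> = M * x ^ 3 - 3 * c\<^sup>2 * ((M * g\<^sup>2) * x) + 2 * c ^ 3 * (M * g ^ 3)"
    by (simp add: algebra_simps power2_eq_square power3_eq_cube)
  finally show ?thesis using g S by simp
qed

lemma mass_constant_pos:
  assumes "\<And>k. m $ k > 0"
  shows "mass_constant m > 0"
proof -
  have "0 < (m $ j * m $ k) powr (3/2) / (m $ j + m $ k) powr (1/2)" for j k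
    using assms[of j] assms[of k]
    by (intro divide_pos_pos) (auto simp: powr_gt_zero add_pos_pos less_imp_neq[symmetric])
  then show ?thesis unfolding mass_constant_def by (intro add_pos_pos)
qed

lemma trace_lower_bound:
  assumes m: "\<And>k. m $ k > 0" and \<alpha>: "\<alpha> > 0" and U: "force_function m z \<ge> \<alpha>"
  shows "(m $ 3 + m $ 2) / cmod (z $ 3 - z $ 2) ^ 3 + (m $ 1 + m $ 3) / cmod (z $ 1 - z $ 3) ^ 3
      + (m $ 2 + m $ 1) / cmod (z $ 2 - z $ 1) ^ 3 \<ge> \<alpha> ^ 3 / (mass_constant m)\<^sup>2"
    (is "?tr \<ge> _")
proof -
  \<comment> \<open>This \<open>c\<close> places the point of tangency on the constraint \<open>U = \<alpha>\<close>.\<close>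
  define c where "c = \<alpha> / mass_constant m"
  have S: "mass_constant m > 0" by (rule mass_constant_pos[OF m])
  have c: "c \<ge> 0" using S \<alpha> by (simp add: c_def)
  have pair: "3 * c\<^sup>2 * (m $ j * m $ k / r) - 2 * c ^ 3 *
      ((m $ j * m $ k) powr (3/2) / (m $ j + m $ k) powr (1/2)) \<le> (m $ j + m $ k) / r ^ 3"
    if "r \<ge> 0" for j k r
    using cube_tangent[of "m $ j * m $ k" "m $ j + m $ k" "1 / r" c] m[of j] m[of k] c that
    by (simp add: power_divide)
  have "3 * c\<^sup>2 * force_function m z - 2 * c ^ 3 * mass_constant m \<le> ?tr"
    using pair[of "cmod (z $ 3 - z $ 2)" 3 2] pair[of "cmod (z $ 1 - z $ 3)" 1 3]
      pair[of "cmod (z $ 2 - z $ 1)" 2 1]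
    unfolding force_function_def mass_constant_def distrib_left by simp
  moreover have "3 * c\<^sup>2 * \<alpha> \<le> 3 * c\<^sup>2 * force_function m z"
    using U by (intro mult_left_mono) auto
  moreover have "3 * c\<^sup>2 * \<alpha> - 2 * c ^ 3 * mass_constant m = \<alpha> ^ 3 / (mass_constant m)\<^sup>2"
    using S by (simp add: c_def field_simps power2_eq_square power3_eq_cube)
  ultimately show ?thesis by linarith
qed

lemma energy_le_force_function:
  assumes "\<And>k. m $ k > 0"
  shows "- energy m z v \<le> force_function m z"
proof -
  have "kinetic_energy m v \<ge> 0"
    unfolding kinetic_energy_def using assms by (auto intro!: sum_nonneg simp: less_imp_le)
  then show ?thesis by (simp add: energy_def)
qed

section \<open>Existence of a syzygy\<close>

theorem theorem2p1:
  fixes m :: "real ^ 3" and \<alpha> T\<^sub>1 :: real and z v :: "real \<Rightarrow> complex ^ 3"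
  assumes masses_pos: "\<And>k. m $ k > 0"
    and alpha_pos: "\<alpha> > 0"
    and T1: "T\<^sub>1 = sqrt 2 * pi * mass_constant m / \<alpha> powr (3/2)"
    and sol: "three_body_solution m {0..T\<^sub>1} z v"
    and coll_free: "collision_free_on {0..T\<^sub>1} z"
    and centre: "\<And>t. t \<in> {0..T\<^sub>1} \<Longrightarrow> (\<Sum>k\<in>UNIV. m $ k *\<^sub>R z t $ k) = 0"
    and momentum: "\<And>t. t \<in> {0..T\<^sub>1} \<Longrightarrow> (\<Sum>k\<in>UNIV. m $ k *\<^sub>R v t $ k) = 0"
    and ang_mom: "\<And>t. t \<in> {0..T\<^sub>1} \<Longrightarrow> angular_momentum m (z t) (v t) = 0"
    and energy: "\<And>t. t \<in> {0..T\<^sub>1} \<Longrightarrow> energy m (z t) (v t) = - \<alpha>"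
  shows "\<exists>t\<^sub>0\<in>{0..T\<^sub>1}. syzygy (z t\<^sub>0)"
proof -
  define acc where "acc = (\<lambda>t. newton_acceleration m (z t))"
  have S: "mass_constant m > 0" by (rule mass_constant_pos[OF masses_pos])
  \<comment> \<open>Half the lower bound for the trace is the square of the comparison frequency.\<close>
  define w where "w = \<alpha> powr (3/2) / (sqrt 2 * mass_constant m)"
  have w: "w > 0" using alpha_pos S by (simp add: w_def)
  have T: "T\<^sub>1 = pi / w" by (simp add: T1 w_def)
  have w2: "2 * w\<^sup>2 = \<alpha> ^ 3 / (mass_constant m)\<^sup>2"
  proof -
    have "(\<alpha> powr (3/2))\<^sup>2 = \<alpha> ^ 3"
      using alpha_pos powr_powr[of \<alpha> "3/2" 2] by simp
    then show ?thesis by (simp add: w_def power_divide power_mult_distrib)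
  qed

  have dz: "((\<lambda>t. z t $ j - z t $ k) has_vector_derivative v t $ j - v t $ k) (at t within {0..T\<^sub>1})"
    and dv: "((\<lambda>t. v t $ j - v t $ k) has_vector_derivative acc t $ j - acc t $ k) (at t within {0..T\<^sub>1})"
    if "t \<in> {0..T\<^sub>1}" for t j k
    using sol that unfolding three_body_solution_def acc_def
    by (auto intro!: has_vector_derivative_diff
        bounded_linear.has_vector_derivative[OF bounded_linear_vec_nth])

  define D where "D = (\<lambda>t. wedge (z t $ 2 - z t $ 1) (z t $ 3 - z t $ 1))"
  define D1 where "D1 = (\<lambda>t. wedge (v t $ 2 - v t $ 1) (z t $ 3 - z t $ 1)
    + wedge (z t $ 2 - z t $ 1) (v t $ 3 - v t $ 1))"
  define V where "V = (\<lambda>t. wedge (v t $ 2 - v t $ 1) (v t $ 3 - v t $ 1))"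
  define D2 where "D2 = (\<lambda>t. wedge (acc t $ 2 - acc t $ 1) (z t $ 3 - z t $ 1)
    + wedge (z t $ 2 - z t $ 1) (acc t $ 3 - acc t $ 1) + 2 * V t)"

  have D: "(D has_real_derivative D1 t) (at t within {0..T\<^sub>1})" if "t \<in> {0..T\<^sub>1}" for t
    unfolding D_def D1_def by (rule has_real_derivative_wedge[OF dz[OF that] dz[OF that]])
  have D1: "(D1 has_real_derivative D2 t) (at t within {0..T\<^sub>1})" if "t \<in> {0..T\<^sub>1}" for t
    unfolding D1_def D2_def V_def
    by (rule DERIV_cong[OF DERIV_add[OF has_real_derivative_wedge[OF dv[OF that] dz[OF that]]
            has_real_derivative_wedge[OF dz[OF that] dv[OF that]]]]) simp
  have ineq: "2 * D t * D2 t \<le> (D1 t)\<^sup>2 - 4 * w\<^sup>2 * (D t)\<^sup>2" if t: "t \<in> {0..T\<^sub>1}" for t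
  proof -
    define tr where "tr = (m $ 3 + m $ 2) / cmod (z t $ 3 - z t $ 2) ^ 3
      + (m $ 1 + m $ 3) / cmod (z t $ 1 - z t $ 3) ^ 3
      + (m $ 2 + m $ 1) / cmod (z t $ 2 - z t $ 1) ^ 3"
    have D2: "D2 t = - tr * D t + 2 * V t"
      unfolding D2_def D_def tr_def acc_def by (simp only: wedge_newton_acceleration)
    have "2 * w\<^sup>2 \<le> tr"
      unfolding w2 tr_def
      using trace_lower_bound[OF masses_pos alpha_pos, of "z t"]
        energy_le_force_function[OF masses_pos, of "z t" "v t"] energy[OF t] by simp
    then have tr: "2 * w\<^sup>2 * (D t)\<^sup>2 \<le> tr * (D t)\<^sup>2" by (intro mult_right_mono) auto
    have disc: "4 * (D t * V t) \<le> (D1 t)\<^sup>2"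
      unfolding D_def V_def D1_def
    proof (rule wedge_discriminant)
      show "m $ 1 * m $ 2 > 0" "m $ 1 * m $ 3 > 0" "m $ 2 * m $ 3 > 0"
        using masses_pos by simp_all
      show "m $ 1 * m $ 2 * wedge (z t $ 2 - z t $ 1) (v t $ 2 - v t $ 1) +
        m $ 1 * m $ 3 * wedge (z t $ 3 - z t $ 1) (v t $ 3 - v t $ 1) +
        m $ 2 * m $ 3 * wedge (z t $ 3 - z t $ 1 - (z t $ 2 - z t $ 1))
          (v t $ 3 - v t $ 1 - (v t $ 2 - v t $ 1)) = 0"
        using mutual_angular_momentum[OF ang_mom[OF t] centre[OF t] momentum[OF t]] by simp
    qed
    have "2 * D t * D2 t = 4 * (D t * V t) - 2 * (tr * (D t)\<^sup>2)"
      unfolding D2 by (simp add: algebra_simps power2_eq_square)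
    with tr disc show ?thesis by linarith
  qed
  obtain t\<^sub>0 where t0: "t\<^sub>0 \<in> {0..T\<^sub>1}" "D t\<^sub>0 = 0"
    using zero_in_half_period[OF w, folded T, OF D D1 ineq] by blast
  then have "syzygy (z t\<^sub>0)"
    unfolding syzygy_def D_def by (intro collinear_if_wedge_eq_0)
  with t0 show ?thesis by blast
qed

end
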